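(* Let $V=R\cup S$ be a finite set, with $R$ (regular agents) and $S$ (stubborn agents) disjoint. Let $W$ be a real square matrix indexed by $V$ such that: (a) $W$ has the block structure $W=\begin{pmatrix}W^R&W^S\\ 0&I\end{pmatrix}$, where the first block of rows and columns is indexed by $R$ and the second by $S$; (b) $W$ is right stochastic: its entries are in $[0,1]$ and $W1_V=1_V$; (c) for the directed edge set $E'$ defined by $(v,w)\in E'\Leftrightarrow W(v,w)>0$, there exists a directed path from each $r\in R$ to at least one $s\in S$. Let $x_0=\begin{pmatrix} x_0^R \\ x^S \end{pmatrix}\in\mathbb{R}^V$ and $x_{n+1}=Wx_n$ for $n\ge0$, and write $x_n=\begin{pmatrix} x_n^R \\ x^S \end{pmatrix}$. Then $x_n^R$ converges, as $n\to\infty$, to $$x_\infty=(I-W^R)^{-1}W^Sx^S .$$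
   Context: $1_V$ denotes the all-ones vector indexed by $V$. $I$ denotes an identity matrix of the appropriate size. By the block structure of $W$, the $S$-component of $x_n$ is constantly equal to $x^S$. The formula for $x_\infty$ is understood to include that $I-W^R$ is invertible. *)

theory Defs
  imports "HOL-Analysis.Analysis"
begin

text \<open>
  The vertex set is the disjoint union of the regular agents \<open>'r\<close> and the stubborn agents \<open>'s\<close>,
  that is, the sum type \<open>'r + 's\<close>. In \<open>real^'n^'m\<close> the rows are indexed by \<open>'m\<close> and the columns
  by \<open>'n\<close>, so \<open>W $ v $ w\<close> is the entry in row \<open>v\<close>, column \<open>w\<close>.
\<close>

definition block_mat ::
  "real^'r^'r \<Rightarrow> real^'s^'r \<Rightarrow> real^'r^'s \<Rightarrow> real^'s^'s \<Rightarrow>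
    real^('r::finite + 's::finite)^('r + 's)" where
  "block_mat A B C D = (\<chi> v w. case v of
      Inl i \<Rightarrow> (case w of Inl j \<Rightarrow> A $ i $ j | Inr j \<Rightarrow> B $ i $ j)
    | Inr i \<Rightarrow> (case w of Inl j \<Rightarrow> C $ i $ j | Inr j \<Rightarrow> D $ i $ j))"

definition block_vec :: "real^'r \<Rightarrow> real^'s \<Rightarrow> real^('r::finite + 's::finite)" where
  "block_vec a b = (\<chi> v. case v of Inl i \<Rightarrow> a $ i | Inr i \<Rightarrow> b $ i)"

definition regular_part :: "real^('r::finite + 's::finite) \<Rightarrow> real^'r" where
  "regular_part x = (\<chi> r. x $ Inl r)"

definition right_stochastic :: "real^'n^'n \<Rightarrow> bool" where
  "right_stochastic W \<longleftrightarrow>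
    (\<forall>v w. W $ v $ w \<in> {0..1}) \<and> W *v (\<chi> v. 1) = (\<chi> v. 1)"

definition positive_edges :: "real^'n^'n \<Rightarrow> ('n \<times> 'n) set" where
  "positive_edges W = {(v, w). W $ v $ w > 0}"

end

theory Submission
  imports Defs
begin

text \<open>
  A harmonic vector, that is \<open>W *v U = U\<close>, attains its maximum also at every vertex reachable from a
  maximum point. As every regular agent reaches a stubborn one, the only \<open>a\<close> with \<open>WR *v a = a\<close> is
  \<open>0\<close>, so \<open>mat 1 - WR\<close> is invertible. The vectors \<open>WR^n *v 1\<close> decrease to a fixed point of \<open>WR\<close>,
  hence to \<open>0\<close>, and they dominate, up to a constant factor, the distance of \<open>x n\<close> to the limit.
\<close>

lemma block_mat_nth [simp]:
  "block_mat A B C D $ Inl i $ Inl j = A $ i $ j"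
  "block_mat A B C D $ Inl i $ Inr k = B $ i $ k"
  "block_mat A B C D $ Inr l $ Inl j = C $ l $ j"
  "block_mat A B C D $ Inr l $ Inr k = D $ l $ k"
  by (simp_all add: block_mat_def)

lemma block_vec_nth [simp]:
  "block_vec a b $ Inl i = a $ i"
  "block_vec a b $ Inr k = b $ k"
  by (simp_all add: block_vec_def)

lemma regular_part_block_vec [simp]: "regular_part (block_vec a b) = a"
  by (simp add: regular_part_def vec_eq_iff)

lemma sum_UNIV_sum:
  "(\<Sum>v\<in>UNIV. f v) = (\<Sum>i\<in>UNIV. f (Inl i)) + (\<Sum>j\<in>UNIV. f (Inr j))"
  for f :: "'r::finite + 's::finite \<Rightarrow> real"
  by (simp add: UNIV_Plus_UNIV [symmetric] sum.Plus del: UNIV_Plus_UNIV)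

lemma block_mat_mult_block_vec:
  "block_mat A B C D *v block_vec a b = block_vec (A *v a + B *v b) (C *v a + D *v b)"
proof -
  have "(block_mat A B C D *v block_vec a b) $ v = block_vec (A *v a + B *v b) (C *v a + D *v b) $ v"
    for v
    by (cases v) (simp_all add: matrix_vector_mult_def sum_UNIV_sum)
  then show ?thesis
    by (simp add: vec_eq_iff)
qed

lemma right_stochasticD:
  assumes "right_stochastic W"
  shows "W $ v $ w \<ge> 0" and "(\<Sum>w\<in>UNIV. W $ v $ w) = 1"
  using assms by (simp_all add: right_stochastic_def matrix_vector_mult_def vec_eq_iff)

text \<open>At a maximum point \<open>y\<close>, the value \<open>m\<close> is the average of the
  values at the other ends of the edges, with weights from row \<open>y\<close>. None exceeds
  \<open>m\<close>, so each one of positive weight equals \<open>m\<close>.\<close>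

lemma harmonic_maximum_propagates:
  fixes W :: "real^'n^'n"
  assumes W: "right_stochastic W" and harmonic: "W *v U = U"
    and max: "\<And>w. U $ w \<le> m" and "U $ v = m"
    and path: "(v, w) \<in> (positive_edges W)\<^sup>*"
  shows "U $ w = m"
  using path
proof (induction rule: rtrancl_induct)
  case base
  show ?case by fact
next
  case (step y z)
  have "(\<Sum>w\<in>UNIV. W $ y $ w * (m - U $ w)) = m * (\<Sum>w\<in>UNIV. W $ y $ w) - (W *v U) $ y"
    by (simp add: matrix_vector_mult_def algebra_simps sum_subtractf sum_distrib_left)
  also have "\<dots> = 0"
    using harmonic step.IH by (simp add: right_stochasticD [OF W])
  finally have "\<forall>w\<in>UNIV. W $ y $ w * (m - U $ w) = 0"
    by (subst (asm) sum_nonneg_eq_0_iff) (simp_all add: right_stochasticD [OF W] max)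
  then have "W $ y $ z * (m - U $ z) = 0"
    by blast
  moreover have "W $ y $ z > 0"
    using step.hyps by (simp add: positive_edges_def)
  ultimately show ?case
    by simp
qed

lemma harmonic_nonpos:
  fixes U :: "real^('r::finite + 's::finite)"
  assumes W: "right_stochastic W" and harmonic: "W *v U = U"
    and path: "\<forall>r. \<exists>s. (Inl r, Inr s) \<in> (positive_edges W)\<^sup>*"
    and boundary: "\<And>s. U $ Inr s \<le> 0"
  shows "U $ v \<le> 0"
proof -
  define m where "m = Max (range (($) U))"
  have max: "U $ w \<le> m" for w
    by (simp add: m_def)
  have "m \<in> range (($) U)"
    unfolding m_def by (rule Max_in) auto
  then obtain w where w: "U $ w = m"
    by blast
  \<comment> \<open>A stubborn \<open>w\<close> reaches itself by the empty path.\<close>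
  obtain s where "(w, Inr s) \<in> (positive_edges W)\<^sup>*"
    using path by (cases w) auto
  then have "U $ Inr s = m"
    by (rule harmonic_maximum_propagates [OF W harmonic max w])
  then show ?thesis
    using max [of v] boundary [of s] by simp
qed

text \<open>Padded with zeros on the stubborn agents, a fixed point of \<open>A\<close> is harmonic
  for the whole matrix. The sign bound then applies to both \<open>a\<close> and
  \<open>- a\<close>.\<close>

lemma regular_fixed_point_eq_0:
  fixes A :: "real^'r::finite^'r" and B :: "real^'s::finite^'r"
  assumes W: "right_stochastic (block_mat A B 0 (mat 1))"
    and path: "\<forall>r. \<exists>s. (Inl r, Inr s) \<in> (positive_edges (block_mat A B 0 (mat 1)))\<^sup>*"
    and fixed: "A *v a = a"
  shows "a = 0"
proof -
  have nonpos: "b $ r \<le> 0" if "A *v b = b" for b r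
    using harmonic_nonpos [OF W _ path, of "block_vec b 0" "Inl r"] that
    by (simp add: block_mat_mult_block_vec)
  have "A *v (- a) = - a"
    using fixed by (simp add: linear_neg [OF matrix_vector_mul_linear])
  then show ?thesis
    using nonpos [OF fixed] nonpos [of "- a"] by (simp add: vec_eq_iff order_antisym)
qed

lemma nonneg_matrix_vector_mono:
  fixes A :: "real^'n^'m"
  assumes "\<And>i j. A $ i $ j \<ge> 0" and "\<And>j. a $ j \<le> b $ j"
  shows "(A *v a) $ i \<le> (A *v b) $ i"
  using assms by (simp add: matrix_vector_mult_def sum_mono mult_left_mono)

lemma nonneg_iterates_tendsto_0:
  fixes A :: "real^'n^'n" and y :: "nat \<Rightarrow> real^'n"
  assumes nonneg: "\<And>i j. A $ i $ j \<ge> 0"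
    and substochastic: "\<And>i. (\<Sum>j\<in>UNIV. A $ i $ j) \<le> 1"
    and fixed: "\<And>a. A *v a = a \<Longrightarrow> a = 0"
    and y_Suc: "\<And>n. y (Suc n) = A *v y n"
  shows "y \<longlonglongrightarrow> 0"
proof -
  \<comment> \<open>Here \<open>1\<close> is the all-ones vector, so \<open>u n\<close> lists the
    row sums of the \<open>n\<close>-th power of \<open>A\<close>.\<close>
  define u where "u = (\<lambda>n. ((*v) A ^^ n) 1)"
  have u_Suc: "u (Suc n) = A *v u n" for n
    by (simp add: u_def)
  note mono = nonneg_matrix_vector_mono [OF nonneg]
  have u_nonneg: "u n $ i \<ge> 0" for n i
  proof (induction n arbitrary: i)
    case (Suc n)
    then show ?case
      using mono [of 0 "u n" i] by (simp add: u_Suc)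
  qed (simp add: u_def)
  have u_decr: "u (Suc n) $ i \<le> u n $ i" for n i
  proof (induction n arbitrary: i)
    case 0
    \<comment> \<open>The entries of \<open>u 1\<close> are the row sums of \<open>A\<close>;
      monotonicity of \<open>A\<close> carries the inequality on to later \<open>n\<close>.\<close>
    show ?case
      using substochastic by (simp add: u_def matrix_vector_mult_def)
  next
    case (Suc n)
    then show ?case
      unfolding u_Suc [of "Suc n"] u_Suc [of n] by (intro mono) (simp flip: u_Suc)
  qed
  have "\<exists>l. (\<lambda>n. u n $ i) \<longlonglongrightarrow> l" for i
  proof -
    have "decseq (\<lambda>n. u n $ i)"
      by (simp add: decseq_Suc_iff u_decr)
    then show ?thesis
      using decseq_convergent u_nonneg by metis
  qed
  then obtain l where l: "\<And>i. (\<lambda>n. u n $ i) \<longlonglongrightarrow> l i"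
    by metis
  have lim: "u \<longlonglongrightarrow> (\<chi> i. l i)"
    by (rule vec_tendstoI) (simp add: l)
  \<comment> \<open>By continuity of \<open>A\<close> and uniqueness of limits, the limit of
    \<open>u\<close> is a fixed point.\<close>
  have "(\<lambda>n. A *v u n) \<longlonglongrightarrow> A *v (\<chi> i. l i)"
    by (rule isCont_tendsto_compose [OF matrix_vector_mult_linear_continuous_at lim])
  moreover have "(\<lambda>n. A *v u n) \<longlonglongrightarrow> (\<chi> i. l i)"
    using LIMSEQ_Suc [OF lim] by (simp add: u_Suc)
  ultimately have "(\<chi> i. l i) = 0"
    by (intro fixed LIMSEQ_unique)
  then have u_lim: "(\<lambda>n. u n $ i) \<longlonglongrightarrow> 0" for i
    using tendsto_vec_nth [OF lim, of i] by simp
  \<comment> \<open>As \<open>u 0\<close> is the all-ones vector, \<open>C\<close> only has to bound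
    every entry of \<open>y 0\<close>.\<close>
  define C where "C = norm (y 0)"
  have bound: "\<bar>y n $ i\<bar> \<le> C * u n $ i" for n i
  proof (induction n arbitrary: i)
    case 0
    show ?case
      by (simp add: u_def C_def component_le_norm_cart)
  next
    case (Suc n)
    have "y n $ j \<le> (C *\<^sub>R u n) $ j" "(- (C *\<^sub>R u n)) $ j \<le> y n $ j" for j
      using Suc [of j] by (simp_all add: abs_le_iff)
    then have "(A *v y n) $ i \<le> (A *v (C *\<^sub>R u n)) $ i" "(A *v (- (C *\<^sub>R u n))) $ i \<le> (A *v y n) $ i"
      by (auto intro!: mono)
    then show ?case
      by (simp add: u_Suc y_Suc abs_le_iff matrix_vector_mult_scaleR
          linear_neg [OF matrix_vector_mul_linear])
  qed
  show ?thesis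
  proof (rule vec_tendstoI)
    fix i
    have "(\<lambda>n. C * u n $ i) \<longlonglongrightarrow> 0"
      using tendsto_mult_right_zero [OF u_lim] .
    then show "(\<lambda>n. y n $ i) \<longlonglongrightarrow> 0 $ i"
      unfolding zero_index by (rule Lim_null_comparison [rotated]) (simp add: bound)
  qed
qed

text \<open>Invertibility is a separate conjunct because \<open>matrix_inv\<close> is a choice term,
  with no determined meaning on a singular matrix.\<close>

theorem proposition7:
  fixes W :: "real^('r::finite + 's::finite)^('r + 's)"
    and WR :: "real^'r^'r"
    and WS :: "real^'s^'r"
    and x0R :: "real^'r"
    and xS :: "real^'s"
    and x :: "nat \<Rightarrow> real^('r + 's)"
  assumes block: "W = block_mat WR WS 0 (mat 1)"
    and stochastic: "right_stochastic W"
    and path: "\<forall>r. \<exists>s. (Inl r, Inr s) \<in> (positive_edges W)\<^sup>*"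
    and x_0: "x 0 = block_vec x0R xS"
    and x_Suc: "\<And>n. x (Suc n) = W *v x n"
  shows "invertible (mat 1 - WR) \<and>
    (\<lambda>n. regular_part (x n)) \<longlonglongrightarrow> matrix_inv (mat 1 - WR) *v (WS *v xS)"
proof
  have fixed: "a = 0" if "WR *v a = a" for a
    using regular_fixed_point_eq_0 [of WR WS] stochastic path that by (simp add: block)
  \<comment> \<open>A square matrix with trivial kernel is invertible, and the kernel of
    \<open>mat 1 - WR\<close> consists of the fixed points of \<open>WR\<close>.\<close>
  then show inv: "invertible (mat 1 - WR)"
    unfolding invertible_left_inverse matrix_left_invertible_ker
    by (simp add: matrix_vector_mult_diff_rdistrib)
  define z where "z = matrix_inv (mat 1 - WR) *v (WS *v xS)"
  have "(mat 1 - WR) ** matrix_inv (mat 1 - WR) = mat 1"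
    using someI_ex [OF inv [unfolded invertible_def]] by (simp add: matrix_inv_def)
  then have "(mat 1 - WR) *v z = WS *v xS"
    by (metis z_def matrix_vector_mul_assoc matrix_vector_mul_lid)
  \<comment> \<open>So \<open>z\<close> is the fixed point of the affine recursion that the regular
    part obeys.\<close>
  then have z: "z = WR *v z + WS *v xS"
    by (simp add: matrix_vector_mult_diff_rdistrib algebra_simps)
  have x: "x n = block_vec (regular_part (x n)) xS" for n
  proof (induction n)
    case (Suc n)
    show ?case
      unfolding x_Suc block by (subst (1 2) Suc) (simp add: block_mat_mult_block_vec)
  qed (simp add: x_0)
  have step: "regular_part (x (Suc n)) = WR *v regular_part (x n) + WS *v xS" for n
    unfolding x_Suc block by (subst x) (simp add: block_mat_mult_block_vec)
  have nonneg: "WR $ i $ j \<ge> 0" for i j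
    using right_stochasticD(1) [OF stochastic, of "Inl i" "Inl j"] by (simp add: block)
  \<comment> \<open>A full row of \<open>W\<close> sums to 1, and its \<open>WS\<close> part is
    nonnegative.\<close>
  have substochastic: "(\<Sum>j\<in>UNIV. WR $ i $ j) \<le> 1" for i
  proof -
    have "WS $ i $ k \<ge> 0" for k
      using right_stochasticD(1) [OF stochastic, of "Inl i" "Inr k"] by (simp add: block)
    then have "(\<Sum>k\<in>UNIV. WS $ i $ k) \<ge> 0"
      by (simp add: sum_nonneg)
    then show ?thesis
      using right_stochasticD(2) [OF stochastic, of "Inl i"] by (simp add: block sum_UNIV_sum)
  qed
  \<comment> \<open>Subtracting \<open>z\<close> cancels the constant term \<open>WS *v xS\<close>
    and leaves a linear iteration.\<close>
  have "regular_part (x (Suc n)) - z = WR *v (regular_part (x n) - z)" for n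
    using z by (simp add: step matrix_vector_mult_diff_distrib algebra_simps)
  with nonneg substochastic fixed have "(\<lambda>n. regular_part (x n) - z) \<longlonglongrightarrow> 0"
    by (rule nonneg_iterates_tendsto_0)
  then show "(\<lambda>n. regular_part (x n)) \<longlonglongrightarrow> matrix_inv (mat 1 - WR) *v (WS *v xS)"
    by (simp add: LIM_zero_iff z_def)
qed

end
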